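(* Let $G=(V,E,\gamma)$, $V=[n]$, be a connected undirected weighted graph, $\hat\delta\in\mathbb{R}^n$, suppose that $\mathcal{U}_{\mathcal S}=\{\delta\in\mathbb{R}^n : |\delta_i-\hat\delta_i|\le\gamma_{ii}\ \forall i\in[n],\ |\delta_i-\delta_j|\le\gamma_{ij}\ \forall\{i,j\}\in E\}$ is nonempty, and let $$\underline\delta_j=\max_{k\in V}\{\hat\delta_k-\gamma_{kk}-\mathrm{dist}(k,j)\},\qquad \bar\delta_j=\min_{k\in V}\{\hat\delta_k+\gamma_{kk}+\mathrm{dist}(k,j)\},\qquad j\in[n].$$ Let $s\in\mathbb{R}^n$. Let $\hat E=\{(k,j),(j,k):\{k,j\}\in E\}$ with $\gamma_{kj}=\gamma_{jk}$, let $d\notin V$ be an additional (dummy) node, and let $E'=\hat E\cup\bigcup_{j\in V}\{(j,d),(d,j)\}$. Consider the linear program (P) in variables $z=(z_a)_{a\in E'}\ge 0$: $$\min_{z\ge 0}\ \sum_{(k,j)\in\hat E}\gamma_{kj}z_{kj}+\sum_{j\in[n]}\bar\delta_jz_{dj}-\sum_{j\in[n]}\underline\delta_jz_{jd}$$ $$\text{subject to}\quad \sum_{k:(k,j)\in\hat E}z_{kj}-\sum_{k:(j,k)\in\hat E}z_{jk}+z_{dj}-z_{jd}=s_j,\qquad j\in[n].\qquad (\ast)$$ Then: (i) (P) is a minimum-cost flow problem in the directed graph $G'=(V\cup\{d\},E')$. (ii) (P) can be rewritten as a minimum-cost flow problem with nonnegative cost coefficients (and hence no negative cycles), namely $$\min_{z\ge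 0}\left\{\sum_{(k,j)\in\hat E}(\gamma_{kj}+\underline\delta_k-\underline\delta_j)z_{kj}+\sum_{j\in[n]}(\bar\delta_j-\underline\delta_j)z_{dj}+\sum_{j\in[n]}\underline\delta_js_j\ \middle|\ (\ast)\right\};$$ that is, the two objectives coincide on the common feasible set, and all coefficients $\gamma_{kj}+\underline\delta_k-\underline\delta_j$, $(k,j)\in\hat E$, and $\bar\delta_j-\underline\delta_j$, $j\in[n]$, are nonnegative (arcs $(j,d)$ have cost zero).
   Context: $[n]=\{1,\dots,n\}$. Weights $\gamma_{ij}=\gamma_{ji}\ge 0$ are given for $\{i,j\}\in E$ (edges join distinct vertices), together with $\gamma_{ii}\ge 0$ for $i\in[n]$. For $i\ne j$, $\mathrm{dist}(i,j)$ is the length of a shortest path between $i$ and $j$ in $G$ with respect to the edge weights $\gamma$, and $\mathrm{dist}(j,j)=0$. The program (P) is the LP dual of the adversarial problem $\max\{\sum_j s_j\delta_j : \delta_k-\delta_j\le\gamma_{kj}\ \forall(k,j)\in\hat E,\ \underline\delta_j\le\delta_j\le\bar\delta_j\ \forall j\in[n]\}$. An (uncapacitated) minimum-cost flow problem in a directed graph $(N,A)$ with arc costs $w$ and node demands $b\in\mathbb{R}^N$, $\sum_{v\in N} b_v=0$, is: minimize $\sum_{a\in A}w_az_a$ (possibly plus a constant) over $z\ge 0$ such that for every node $v\in N$ the inflow minus the outflow equals $b_v$. Saying that (P) is such a problem in $G'$ means that, for some demand vector $b$ on $V\cup\{d\}$ with zero sum, its feasible set is exactly the set of flows in $G'$ satisfying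 flow conservation at every node of $V\cup\{d\}$, and its objective is linear in the arc flows. *)

theory Defs
  imports "HOL-Library.FuncSet" "Graph_Theory.Graph_Theory"
begin

section \<open>Minimum-cost flow problems\<close>

text \<open>Vectors indexed by a set \<open>A\<close> are functions that are \<open>undefined\<close> outside \<open>A\<close>.\<close>

definition flows :: "('v, 'a) pre_digraph \<Rightarrow> ('v \<Rightarrow> real) \<Rightarrow> ('a \<Rightarrow> real) set" where
  "flows N b = {z \<in> arcs N \<rightarrow>\<^sub>E {0..}.
     \<forall>v\<in>verts N. (\<Sum>a\<in>in_arcs N v. z a) - (\<Sum>a\<in>out_arcs N v. z a) = b v}"

text \<open>
  The optimization problem of minimizing \<open>f\<close> over \<open>F\<close> is the uncapacitated minimum-cost
  flow problem in \<open>N\<close> with arc costs \<open>w\<close> and additive constant \<open>c\<close>, for some demand vector.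
\<close>

definition min_cost_flow_problem ::
    "('v, 'a) pre_digraph \<Rightarrow> ('a \<Rightarrow> real) \<Rightarrow> real \<Rightarrow> ('a \<Rightarrow> real) set \<Rightarrow> (('a \<Rightarrow> real) \<Rightarrow> real) \<Rightarrow> bool" where
  "min_cost_flow_problem N w c F f \<longleftrightarrow>
     fin_digraph N \<and>
     (\<exists>b. (\<Sum>v\<in>verts N. b v) = 0 \<and> F = flows N b) \<and>
     (\<forall>z\<in>extensional (arcs N). f z = (\<Sum>a\<in>arcs N. w a * z a) + c)"

section \<open>The graph and the bounds\<close>

text \<open>
  An undirected graph on \<open>{1..n}\<close> is given by its set \<open>E\<close> of two-element edges. Its paths
  and connectedness are those of the associated symmetric digraph. The weights \<open>\<gamma> i j\<close> are used for \<open>{i, j} \<in> E\<close> and for \<open>i = j\<close>.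
\<close>

definition both_dirs :: "nat set set \<Rightarrow> (nat \<times> nat) set" where
  "both_dirs E = {(k, j). {k, j} \<in> E}"

definition graph_of :: "nat \<Rightarrow> nat set set \<Rightarrow> (nat, nat \<times> nat) pre_digraph" where
  "graph_of n E = \<lparr>verts = {1..n}, arcs = both_dirs E, tail = fst, head = snd\<rparr>"

text \<open>
  An \<open>apath\<close> repeats no vertex, so the minimum is over a finite set, and the only such path
  from a vertex to itself is the empty one, of length \<open>0\<close>.
\<close>

definition path_dist :: "nat \<Rightarrow> nat set set \<Rightarrow> (nat \<Rightarrow> nat \<Rightarrow> real) \<Rightarrow> nat \<Rightarrow> nat \<Rightarrow> real" where
  "path_dist n E \<gamma> i j =
     Min {wf_digraph.awalk_cost (\<lambda>(k, l). \<gamma> k l) p | p. pre_digraph.apath (graph_of n E) i p j}"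

lemma path_dist_self:
  assumes "j \<in> {1..n}"
  shows "path_dist n E \<gamma> j j = 0"
proof -
  have apath_iff: "pre_digraph.apath (graph_of n E) j p j \<longleftrightarrow> p = []" for p
  proof (cases p)
    case Nil
    with assms show ?thesis
      by (simp add: pre_digraph.apath_def pre_digraph.awalk_def pre_digraph.cas.simps
          pre_digraph.awalk_verts.simps graph_of_def)
  next
    case (Cons e es)
    have last: "pre_digraph.cas G u q v \<Longrightarrow> v \<in> set (pre_digraph.awalk_verts G u q)"
      for G :: "(nat, nat \<times> nat) pre_digraph" and u v q
      by (induction q arbitrary: u) (auto simp: pre_digraph.cas.simps pre_digraph.awalk_verts.simps)
    show ?thesis
      using last[of "graph_of n E" "snd e" es j] Cons
      by (auto simp: pre_digraph.apath_def pre_digraph.awalk_def pre_digraph.cas.simps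
          pre_digraph.awalk_verts.simps graph_of_def)
  qed
  have "wf_digraph (\<lparr>verts = {}, arcs = {}, tail = fst, head = snd\<rparr> :: (nat, nat \<times> nat) pre_digraph)"
    by unfold_locales auto
  then have "wf_digraph.awalk_cost (\<lambda>(k, l). \<gamma> k l) [] = 0"
    by (rule wf_digraph.awalk_cost_Nil)
  then show ?thesis
    by (simp add: path_dist_def apath_iff)
qed

definition uncertainty_set ::
    "nat \<Rightarrow> nat set set \<Rightarrow> (nat \<Rightarrow> nat \<Rightarrow> real) \<Rightarrow> (nat \<Rightarrow> real) \<Rightarrow> (nat \<Rightarrow> real) set" where
  "uncertainty_set n E \<gamma> \<delta>hat = {\<delta> \<in> {1..n} \<rightarrow>\<^sub>E UNIV.
     (\<forall>i\<in>{1..n}. \<bar>\<delta> i - \<delta>hat i\<bar> \<le> \<gamma> i i) \<and>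
     (\<forall>i j. {i, j} \<in> E \<longrightarrow> \<bar>\<delta> i - \<delta> j\<bar> \<le> \<gamma> i j)}"

definition lower_bd ::
    "nat \<Rightarrow> nat set set \<Rightarrow> (nat \<Rightarrow> nat \<Rightarrow> real) \<Rightarrow> (nat \<Rightarrow> real) \<Rightarrow> nat \<Rightarrow> real" where
  "lower_bd n E \<gamma> \<delta>hat j = Max ((\<lambda>k. \<delta>hat k - \<gamma> k k - path_dist n E \<gamma> k j) ` {1..n})"

definition upper_bd ::
    "nat \<Rightarrow> nat set set \<Rightarrow> (nat \<Rightarrow> nat \<Rightarrow> real) \<Rightarrow> (nat \<Rightarrow> real) \<Rightarrow> nat \<Rightarrow> real" where
  "upper_bd n E \<gamma> \<delta>hat j = Min ((\<lambda>k. \<delta>hat k + \<gamma> k k + path_dist n E \<gamma> k j) ` {1..n})"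

section \<open>The linear program\<close>

definition ext_graph :: "nat \<Rightarrow> nat set set \<Rightarrow> nat \<Rightarrow> (nat, nat \<times> nat) pre_digraph" where
  "ext_graph n E d = \<lparr>verts = {1..n} \<union> {d},
     arcs = both_dirs E \<union> (\<Union>j\<in>{1..n}. {(j, d), (d, j)}), tail = fst, head = snd\<rparr>"

definition lp_feasible ::
    "nat \<Rightarrow> nat set set \<Rightarrow> nat \<Rightarrow> (nat \<Rightarrow> real) \<Rightarrow> (nat \<times> nat \<Rightarrow> real) set" where
  "lp_feasible n E d s = {z \<in> arcs (ext_graph n E d) \<rightarrow>\<^sub>E {0..}.
     \<forall>j\<in>{1..n}. (\<Sum>k | (k, j) \<in> both_dirs E. z (k, j)) - (\<Sum>k | (j, k) \<in> both_dirs E. z (j, k))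
       + z (d, j) - z (j, d) = s j}"

definition lp_objective ::
    "nat \<Rightarrow> nat set set \<Rightarrow> (nat \<Rightarrow> nat \<Rightarrow> real) \<Rightarrow> (nat \<Rightarrow> real) \<Rightarrow> nat \<Rightarrow> (nat \<times> nat \<Rightarrow> real) \<Rightarrow> real" where
  "lp_objective n E \<gamma> \<delta>hat d z =
     (\<Sum>(k, j)\<in>both_dirs E. \<gamma> k j * z (k, j))
     + (\<Sum>j\<in>{1..n}. upper_bd n E \<gamma> \<delta>hat j * z (d, j))
     - (\<Sum>j\<in>{1..n}. lower_bd n E \<gamma> \<delta>hat j * z (j, d))"

definition lp_cost ::
    "nat \<Rightarrow> nat set set \<Rightarrow> (nat \<Rightarrow> nat \<Rightarrow> real) \<Rightarrow> (nat \<Rightarrow> real) \<Rightarrow> nat \<Rightarrow> nat \<times> nat \<Rightarrow> real" where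
  "lp_cost n E \<gamma> \<delta>hat d = (\<lambda>(k, j).
     if k = d then upper_bd n E \<gamma> \<delta>hat j
     else if j = d then - lower_bd n E \<gamma> \<delta>hat k
     else \<gamma> k j)"

definition red_objective ::
    "nat \<Rightarrow> nat set set \<Rightarrow> (nat \<Rightarrow> nat \<Rightarrow> real) \<Rightarrow> (nat \<Rightarrow> real) \<Rightarrow> nat \<Rightarrow> (nat \<Rightarrow> real)
      \<Rightarrow> (nat \<times> nat \<Rightarrow> real) \<Rightarrow> real" where
  "red_objective n E \<gamma> \<delta>hat d s z =
     (\<Sum>(k, j)\<in>both_dirs E.
        (\<gamma> k j + lower_bd n E \<gamma> \<delta>hat k - lower_bd n E \<gamma> \<delta>hat j) * z (k, j))
     + (\<Sum>j\<in>{1..n}. (upper_bd n E \<gamma> \<delta>hat j - lower_bd n E \<gamma> \<delta>hat j) * z (d, j))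
     + (\<Sum>j\<in>{1..n}. lower_bd n E \<gamma> \<delta>hat j * s j)"

definition red_cost ::
    "nat \<Rightarrow> nat set set \<Rightarrow> (nat \<Rightarrow> nat \<Rightarrow> real) \<Rightarrow> (nat \<Rightarrow> real) \<Rightarrow> nat \<Rightarrow> nat \<times> nat \<Rightarrow> real" where
  "red_cost n E \<gamma> \<delta>hat d = (\<lambda>(k, j).
     if k = d then upper_bd n E \<gamma> \<delta>hat j - lower_bd n E \<gamma> \<delta>hat j
     else if j = d then 0
     else \<gamma> k j + lower_bd n E \<gamma> \<delta>hat k - lower_bd n E \<gamma> \<delta>hat j)"

end

theory Submission
  imports Defs
begin

text \<open>
  Everything rests on the effect of a node potential \<open>\<pi>\<close> on a flow \<open>z\<close>: in
  \<open>\<Sum>\<^sub>v \<pi> v \<cdot> excess v\<close>, where the excess is inflow minus outflow, each arc \<open>a\<close> contributes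
  \<open>z a\<close> once at its head and once, negatively, at its tail, so the sum equals
  \<open>\<Sum>\<^sub>a (\<pi> (head a) - \<pi> (tail a)) z a\<close> (\<open>sum_potential_excess\<close>).

  With \<open>\<pi> = 1\<close> all excesses sum to zero. The linear program prescribes the excess \<open>s j\<close> at
  each \<open>j\<close>, so the excess at the dummy node \<open>d\<close> is forced to be \<open>- \<Sum>\<^sub>j s j\<close>; hence adding
  conservation at \<open>d\<close> with this demand does not change the feasible set
  (\<open>lp_feasible_eq_flows\<close>).

  With \<open>\<pi>\<close> equal to the lower bounds on \<open>{1..n}\<close> and to \<open>0\<close> at \<open>d\<close>, replacing each arc cost
  by \<open>cost + \<pi> (tail a) - \<pi> (head a)\<close> gives exactly the reduced costs, and on feasible
  flows it changes the objective by the constant \<open>\<Sum>\<^sub>j \<pi> j s j\<close>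
  (\<open>lp_objective_eq_red_objective\<close>).

  The reduced costs are nonnegative for two reasons. On an edge, the distances obey the
  triangle inequality, so the lower bounds of adjacent vertices differ by at most the weight
  of the edge (\<open>lower_bd_step\<close>). On an arc leaving \<open>d\<close>, a point of the uncertainty set lies
  between the two bounds: adding the edge constraints along a path bounds the difference of
  its values at the two ends by the length of the path (\<open>uncertainty_set_bounds\<close>).
\<close>

section \<open>Node potentials\<close>

lemma (in fin_digraph) sum_potential_excess:
  fixes \<pi> :: "'a \<Rightarrow> real" and z :: "'b \<Rightarrow> real"
  shows "(\<Sum>v\<in>verts G. \<pi> v * ((\<Sum>a\<in>in_arcs G v. z a) - (\<Sum>a\<in>out_arcs G v. z a)))
    = (\<Sum>a\<in>arcs G. (\<pi> (head G a) - \<pi> (tail G a)) * z a)"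
proof -
  \<comment> \<open>used once with \<open>h\<close> the head and once with \<open>h\<close> the tail\<close>
  have regroup: "(\<Sum>v\<in>verts G. \<pi> v * (\<Sum>a | a \<in> arcs G \<and> h a = v. z a)) = (\<Sum>a\<in>arcs G. \<pi> (h a) * z a)"
    if "\<And>a. a \<in> arcs G \<Longrightarrow> h a \<in> verts G" for h :: "'b \<Rightarrow> 'a"
  proof -
    have "(\<Sum>v\<in>verts G. \<pi> v * (\<Sum>a | a \<in> arcs G \<and> h a = v. z a))
        = (\<Sum>v\<in>verts G. \<Sum>a | a \<in> arcs G \<and> h a = v. \<pi> (h a) * z a)"
      by (auto simp: sum_distrib_left intro!: sum.cong)
    also have "\<dots> = (\<Sum>a\<in>arcs G. \<pi> (h a) * z a)"
      using that by (intro sum.group) auto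
    finally show ?thesis .
  qed
  show ?thesis
    by (simp add: in_arcs_def out_arcs_def right_diff_distrib left_diff_distrib sum_subtractf regroup)
qed

section \<open>The network with the dummy node\<close>

locale finite_graph =
  fixes n :: nat and E :: "nat set set"
  assumes edges: "\<And>e. e \<in> E \<Longrightarrow> \<exists>i\<in>{1..n}. \<exists>j\<in>{1..n}. i \<noteq> j \<and> e = {i, j}"
begin

lemma both_dirs_verts:
  assumes "(i, j) \<in> both_dirs E"
  shows "i \<in> {1..n}" "j \<in> {1..n}"
  using edges[of "{i, j}"] assms by (auto simp: both_dirs_def doubleton_eq_iff)

lemma finite_both_dirs: "finite (both_dirs E)"
  by (rule finite_subset[of _ "{1..n} \<times> {1..n}"]) (use both_dirs_verts in auto)

lemma both_dirs_commute: "(i, j) \<in> both_dirs E \<longleftrightarrow> (j, i) \<in> both_dirs E"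
  by (simp add: both_dirs_def insert_commute)

lemma graph_of_simps:
  "verts (graph_of n E) = {1..n}" "arcs (graph_of n E) = both_dirs E"
  "tail (graph_of n E) = fst" "head (graph_of n E) = snd"
  by (simp_all add: graph_of_def)

sublocale G: fin_digraph "graph_of n E"
proof (unfold_locales, goal_cases)
  case (1 e) then show ?case using both_dirs_verts(1)[of "fst e" "snd e"] by (simp add: graph_of_def)
next
  case (2 e) then show ?case using both_dirs_verts(2)[of "fst e" "snd e"] by (simp add: graph_of_def)
next
  case 3 show ?case by (simp add: graph_of_def)
next
  case 4 show ?case by (simp add: graph_of_def finite_both_dirs)
qed

end

locale dummy_network = finite_graph +
  fixes d :: nat
  assumes dummy: "d \<notin> {1..n}"
begin

abbreviation N :: "(nat, nat \<times> nat) pre_digraph" where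
  "N \<equiv> ext_graph n E d"

lemma no_edge_at_dummy: "(d, j) \<notin> both_dirs E" "(j, d) \<notin> both_dirs E"
  using both_dirs_verts dummy by blast+

lemma arcs_N: "arcs N = both_dirs E \<union> (\<lambda>j. (d, j)) ` {1..n} \<union> (\<lambda>j. (j, d)) ` {1..n}"
  by (auto simp: ext_graph_def)

lemma verts_N: "verts N = insert d {1..n}"
  by (simp add: ext_graph_def)

lemma tail_head_N: "tail N = fst" "head N = snd"
  by (simp_all add: ext_graph_def)

sublocale N: fin_digraph N
proof unfold_locales
  fix e assume "e \<in> arcs N"
  then show "tail N e \<in> verts N" "head N e \<in> verts N"
    using both_dirs_verts[of "fst e" "snd e"] by (auto simp: arcs_N verts_N tail_head_N)
qed (simp_all add: arcs_N verts_N finite_both_dirs)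

lemma sum_arcs_N:
  fixes f :: "nat \<times> nat \<Rightarrow> real"
  shows "(\<Sum>a\<in>arcs N. f a) = (\<Sum>a\<in>both_dirs E. f a) + (\<Sum>j\<in>{1..n}. f (d, j)) + (\<Sum>j\<in>{1..n}. f (j, d))"
proof -
  have "both_dirs E \<inter> (\<lambda>j. (d, j)) ` {1..n} = {}"
    using no_edge_at_dummy by auto
  moreover have "(both_dirs E \<union> (\<lambda>j. (d, j)) ` {1..n}) \<inter> (\<lambda>j. (j, d)) ` {1..n} = {}"
    using no_edge_at_dummy dummy by auto
  ultimately show ?thesis
    by (simp add: arcs_N sum.union_disjoint finite_both_dirs sum.reindex inj_on_def)
qed

lemma excess_N:
  fixes z :: "nat \<times> nat \<Rightarrow> real"
  assumes j: "j \<in> {1..n}"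
  shows "(\<Sum>a\<in>in_arcs N j. z a) - (\<Sum>a\<in>out_arcs N j. z a)
    = (\<Sum>k | (k, j) \<in> both_dirs E. z (k, j)) - (\<Sum>k | (j, k) \<in> both_dirs E. z (j, k))
      + z (d, j) - z (j, d)"
proof -
  have neq: "j \<noteq> d"
    using j dummy by auto
  have fin: "finite {k. (k, j) \<in> both_dirs E}" "finite {k. (j, k) \<in> both_dirs E}"
    using both_dirs_verts by (auto intro: finite_subset[of _ "{1..n}"])
  have "in_arcs N j = insert (d, j) ((\<lambda>k. (k, j)) ` {k. (k, j) \<in> both_dirs E})"
    using j neq by (auto simp: in_arcs_def arcs_N tail_head_N)
  moreover have "out_arcs N j = insert (j, d) ((\<lambda>k. (j, k)) ` {k. (j, k) \<in> both_dirs E})"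
    using j neq by (auto simp: out_arcs_def arcs_N tail_head_N)
  ultimately show ?thesis
    using no_edge_at_dummy fin by (simp add: sum.insert_if image_iff sum.reindex inj_on_def)
qed

text \<open>
  The program says nothing about \<open>d\<close>. Conservation there comes for free, because the
  excesses of all nodes sum to zero; this dictates the demand at \<open>d\<close>.
\<close>

lemma lp_feasible_eq_flows:
  "lp_feasible n E d s = flows N (\<lambda>v. if v = d then - (\<Sum>j\<in>{1..n}. s j) else s v)"
proof -
  have "(\<Sum>a\<in>in_arcs N d. z a) - (\<Sum>a\<in>out_arcs N d. z a) = - (\<Sum>j\<in>{1..n}. s j)"
    if "\<forall>j\<in>{1..n}. (\<Sum>a\<in>in_arcs N j. z a) - (\<Sum>a\<in>out_arcs N j. z a) = s j" for z
    using N.sum_potential_excess[of "\<lambda>_. 1" z] that dummy by (simp add: verts_N)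
  moreover have "j \<noteq> d" if "j \<in> {1..n}" for j
    using that dummy by auto
  ultimately show ?thesis
    by (auto simp: lp_feasible_def flows_def excess_N[symmetric] verts_N simp del: atLeastAtMost_iff)
qed

lemma min_cost_flow_problem_lp_feasible:
  assumes "\<And>z. f z = (\<Sum>a\<in>arcs N. w a * z a) + c"
  shows "min_cost_flow_problem N w c (lp_feasible n E d s) f"
proof -
  have "(\<Sum>v\<in>{1..n}. if v = d then - (\<Sum>j\<in>{1..n}. s j) else s v) = (\<Sum>j\<in>{1..n}. s j)"
    using dummy by (intro sum.cong) auto
  then have "(\<Sum>v\<in>verts N. if v = d then - (\<Sum>j\<in>{1..n}. s j) else s v) = 0"
    using dummy by (simp add: verts_N)
  then show ?thesis
    unfolding min_cost_flow_problem_def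
    using N.fin_digraph_axioms lp_feasible_eq_flows assms by blast
qed

lemma lp_objective_eq_arc_sum:
  "lp_objective n E \<gamma> \<delta>hat d z = (\<Sum>a\<in>arcs N. lp_cost n E \<gamma> \<delta>hat d a * z a)"
proof -
  have "(\<Sum>a\<in>both_dirs E. lp_cost n E \<gamma> \<delta>hat d a * z a) = (\<Sum>(k, j)\<in>both_dirs E. \<gamma> k j * z (k, j))"
    using no_edge_at_dummy by (auto simp: lp_cost_def intro!: sum.cong)
  moreover have "(\<Sum>j\<in>{1..n}. lp_cost n E \<gamma> \<delta>hat d (j, d) * z (j, d))
      = - (\<Sum>j\<in>{1..n}. lower_bd n E \<gamma> \<delta>hat j * z (j, d))"
    using dummy by (auto simp: lp_cost_def simp flip: sum_negf intro!: sum.cong)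
  ultimately show ?thesis
    by (simp add: sum_arcs_N lp_objective_def lp_cost_def)
qed

lemma red_objective_eq_arc_sum:
  "red_objective n E \<gamma> \<delta>hat d s z
    = (\<Sum>a\<in>arcs N. red_cost n E \<gamma> \<delta>hat d a * z a) + (\<Sum>j\<in>{1..n}. lower_bd n E \<gamma> \<delta>hat j * s j)"
proof -
  have "(\<Sum>a\<in>both_dirs E. red_cost n E \<gamma> \<delta>hat d a * z a)
      = (\<Sum>(k, j)\<in>both_dirs E. (\<gamma> k j + lower_bd n E \<gamma> \<delta>hat k - lower_bd n E \<gamma> \<delta>hat j) * z (k, j))"
    using no_edge_at_dummy by (auto simp: red_cost_def intro!: sum.cong)
  moreover have "(\<Sum>j\<in>{1..n}. red_cost n E \<gamma> \<delta>hat d (j, d) * z (j, d)) = 0"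
    using dummy by (auto simp: red_cost_def intro!: sum.neutral)
  ultimately show ?thesis
    by (simp add: sum_arcs_N red_objective_def red_cost_def)
qed

text \<open>
  The reduced costs come from the potential that is the lower bound on \<open>{1..n}\<close>. Its value at
  \<open>d\<close> must be \<open>0\<close>: then the arcs into \<open>d\<close> become free of cost, and the unspecified excess at
  \<open>d\<close> does not enter the constant.
\<close>

lemma lp_objective_eq_red_objective:
  assumes "z \<in> lp_feasible n E d s"
  shows "lp_objective n E \<gamma> \<delta>hat d z = red_objective n E \<gamma> \<delta>hat d s z"
proof -
  define \<pi> where "\<pi> v = (if v = d then 0 else lower_bd n E \<gamma> \<delta>hat v)" for v
  have neq: "j \<noteq> d" if "j \<in> {1..n}" for j
    using that dummy by auto
  have "lp_cost n E \<gamma> \<delta>hat d a - red_cost n E \<gamma> \<delta>hat d a = \<pi> (head N a) - \<pi> (tail N a)" if "a \<in> arcs N" for a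
    using that neq no_edge_at_dummy
    by (cases a) (auto simp: arcs_N tail_head_N lp_cost_def red_cost_def \<pi>_def simp del: atLeastAtMost_iff)
  then have "(\<Sum>a\<in>arcs N. lp_cost n E \<gamma> \<delta>hat d a * z a) - (\<Sum>a\<in>arcs N. red_cost n E \<gamma> \<delta>hat d a * z a)
      = (\<Sum>v\<in>verts N. \<pi> v * ((\<Sum>a\<in>in_arcs N v. z a) - (\<Sum>a\<in>out_arcs N v. z a)))"
    unfolding N.sum_potential_excess sum_subtractf[symmetric] left_diff_distrib[symmetric]
    by (intro sum.cong) auto
  also have "\<dots> = (\<Sum>j\<in>{1..n}. lower_bd n E \<gamma> \<delta>hat j * s j)"
    using assms dummy neq
    by (auto simp: verts_N \<pi>_def lp_feasible_eq_flows flows_def simp del: atLeastAtMost_iff intro!: sum.cong)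
  finally show ?thesis
    by (simp add: lp_objective_eq_arc_sum red_objective_eq_arc_sum)
qed

end

section \<open>Shortest paths and the bounds\<close>

locale weighted_graph = finite_graph +
  fixes \<gamma> :: "nat \<Rightarrow> nat \<Rightarrow> real"
  assumes conn: "connected (graph_of n E)"
    and weight_nonneg: "\<And>i j. {i, j} \<in> E \<Longrightarrow> 0 \<le> \<gamma> i j"
begin

abbreviation len :: "(nat \<times> nat) list \<Rightarrow> real" where
  "len \<equiv> G.awalk_cost (\<lambda>(k, l). \<gamma> k l)"

text \<open>
  Distances are minima over vertex-simple paths. Cutting the cycles out of a walk cannot make
  it longer when weights are nonnegative, so walks, which can be concatenated freely, may be
  used instead.
\<close>

lemma path_dist_le_awalk:
  assumes "G.awalk i p j"
  shows "path_dist n E \<gamma> i j \<le> len p"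
proof -
  have "0 \<le> len c" if "G.awalk w c w" for w c
    using that by (rule G.pos_cost_pos_awalk_cost)
      (auto simp: graph_of_def both_dirs_def weight_nonneg)
  then have "len (G.awalk_to_apath p) \<le> len p"
    by (intro G.awalk_to_path_no_neg_cyc_cost[OF assms]) (auto simp: not_less)
  moreover have "path_dist n E \<gamma> i j \<le> len (G.awalk_to_apath p)"
    unfolding path_dist_def using G.apaths_finite G.apath_awalk_to_apath[OF assms]
    by (intro Min_le) auto
  ultimately show ?thesis
    by simp
qed

text \<open>
  Without connectedness \<open>path_dist\<close> could be a minimum over the empty set, which says nothing.
\<close>

lemma path_dist_attained:
  assumes "i \<in> {1..n}" "j \<in> {1..n}"
  obtains p where "G.awalk i p j" "path_dist n E \<gamma> i j = len p"
proof -
  have "arcs_ends (mk_symmetric (graph_of n E)) = arcs_ends (graph_of n E)"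
    using both_dirs_commute
    by (auto simp: parcs_mk_symmetric arcs_ends_conv arc_to_ends_def graph_of_def)
  then have "i \<rightarrow>\<^sup>*\<^bsub>graph_of n E\<^esub> j"
    using conn assms by (auto simp: connected_def strongly_connected_def reachable_def graph_of_def)
  then obtain p where "G.apath i p j"
    unfolding G.reachable_apath by blast
  then have "path_dist n E \<gamma> i j \<in> {len p | p. G.apath i p j}"
    unfolding path_dist_def using G.apaths_finite by (intro Min_in) auto
  then show thesis
    using that by (auto intro: G.awalkI_apath)
qed

text \<open>The only case of the triangle inequality that the bounds require.\<close>

lemma path_dist_step:
  assumes i: "i \<in> {1..n}" and kj: "(k, j) \<in> both_dirs E"
  shows "path_dist n E \<gamma> i j \<le> path_dist n E \<gamma> i k + \<gamma> k j"
proof -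
  obtain p where p: "G.awalk i p k" "path_dist n E \<gamma> i k = len p"
    using path_dist_attained[OF i both_dirs_verts(1)[OF kj]] .
  have "G.awalk k [(k, j)] j"
    using kj both_dirs_verts[OF kj] by (simp add: G.awalk_Cons_iff G.awalk_Nil_iff graph_of_simps)
  with p(1) have "G.awalk i (p @ [(k, j)]) j"
    by (rule G.awalk_appendI)
  from path_dist_le_awalk[OF this] p(2) show ?thesis
    by simp
qed

text \<open>
  A vertex that attains the maximum for \<open>k\<close> is a candidate for \<open>j\<close>, and its distance to \<open>j\<close>
  exceeds that to \<open>k\<close> by at most the weight of the edge.
\<close>

lemma lower_bd_step:
  assumes kj: "(k, j) \<in> both_dirs E"
  shows "lower_bd n E \<gamma> \<delta>hat k \<le> lower_bd n E \<gamma> \<delta>hat j + \<gamma> k j"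
proof -
  have "lower_bd n E \<gamma> \<delta>hat k \<in> (\<lambda>i. \<delta>hat i - \<gamma> i i - path_dist n E \<gamma> i k) ` {1..n}"
    unfolding lower_bd_def using both_dirs_verts[OF kj] by (intro Max_in) auto
  then obtain i where i: "i \<in> {1..n}" "lower_bd n E \<gamma> \<delta>hat k = \<delta>hat i - \<gamma> i i - path_dist n E \<gamma> i k"
    by blast
  have "\<delta>hat i - \<gamma> i i - path_dist n E \<gamma> i j \<le> lower_bd n E \<gamma> \<delta>hat j"
    unfolding lower_bd_def using i(1) by (intro Max_ge) auto
  with i path_dist_step[OF i(1) kj] show ?thesis
    by simp
qed

text \<open>
  The edge constraints telescope along every walk, in particular along a shortest one.
\<close>

lemma uncertainty_set_path_dist:
  assumes \<delta>: "\<delta> \<in> uncertainty_set n E \<gamma> \<delta>hat" and ij: "i \<in> {1..n}" "j \<in> {1..n}"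
  shows "\<bar>\<delta> i - \<delta> j\<bar> \<le> path_dist n E \<gamma> i j"
proof -
  have "\<bar>\<delta> i - \<delta> j\<bar> \<le> len p" if "G.awalk i p j" for p
    using that
  proof (induction p arbitrary: i)
    case Nil then show ?case by (simp add: G.awalk_Nil_iff)
  next
    case (Cons a p)
    obtain l where a: "a = (i, l)" "{i, l} \<in> E" and p: "G.awalk l p j"
      using Cons.prems by (cases a) (auto simp: G.awalk_Cons_iff graph_of_simps both_dirs_def)
    have "\<bar>\<delta> i - \<delta> l\<bar> \<le> \<gamma> i l"
      using \<delta> a(2) by (simp add: uncertainty_set_def)
    with Cons.IH[OF p] a show ?case
      by simp
  qed
  then show ?thesis
    using path_dist_attained[OF ij] by metis
qed

lemma uncertainty_set_bounds:
  assumes \<delta>: "\<delta> \<in> uncertainty_set n E \<gamma> \<delta>hat" and j: "j \<in> {1..n}"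
  shows "lower_bd n E \<gamma> \<delta>hat j \<le> \<delta> j" "\<delta> j \<le> upper_bd n E \<gamma> \<delta>hat j"
proof -
  have bound: "\<delta>hat k - \<gamma> k k - path_dist n E \<gamma> k j \<le> \<delta> j \<and> \<delta> j \<le> \<delta>hat k + \<gamma> k k + path_dist n E \<gamma> k j"
    if k: "k \<in> {1..n}" for k
  proof -
    have "\<bar>\<delta> k - \<delta>hat k\<bar> \<le> \<gamma> k k"
      using \<delta> k by (auto simp: uncertainty_set_def)
    with uncertainty_set_path_dist[OF \<delta> k j] show ?thesis
      by linarith
  qed
  show "lower_bd n E \<gamma> \<delta>hat j \<le> \<delta> j"
    unfolding lower_bd_def using j bound by (intro Max.boundedI) auto
  show "\<delta> j \<le> upper_bd n E \<gamma> \<delta>hat j"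
    unfolding upper_bd_def using j bound by (intro Min.boundedI) auto
qed

end

theorem proposition15:
  fixes n d :: nat and E :: "nat set set" and \<gamma> :: "nat \<Rightarrow> nat \<Rightarrow> real" and \<delta>hat s :: "nat \<Rightarrow> real"
  assumes edges: "\<And>e. e \<in> E \<Longrightarrow> \<exists>i\<in>{1..n}. \<exists>j\<in>{1..n}. i \<noteq> j \<and> e = {i, j}"
    and conn: "connected (graph_of n E)"
    and weight_sym: "\<And>i j. {i, j} \<in> E \<Longrightarrow> \<gamma> i j = \<gamma> j i"
    and weight_nonneg: "\<And>i j. {i, j} \<in> E \<Longrightarrow> 0 \<le> \<gamma> i j"
    and diag_nonneg: "\<And>i. i \<in> {1..n} \<Longrightarrow> 0 \<le> \<gamma> i i"
    and nonempty: "uncertainty_set n E \<gamma> \<delta>hat \<noteq> {}"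
    and dummy: "d \<notin> {1..n}"
  shows "min_cost_flow_problem (ext_graph n E d) (lp_cost n E \<gamma> \<delta>hat d) 0
      (lp_feasible n E d s) (lp_objective n E \<gamma> \<delta>hat d)
    \<and> min_cost_flow_problem (ext_graph n E d) (red_cost n E \<gamma> \<delta>hat d)
      (\<Sum>j\<in>{1..n}. lower_bd n E \<gamma> \<delta>hat j * s j)
      (lp_feasible n E d s) (red_objective n E \<gamma> \<delta>hat d s)
    \<and> (\<forall>z\<in>lp_feasible n E d s. lp_objective n E \<gamma> \<delta>hat d z = red_objective n E \<gamma> \<delta>hat d s z)
    \<and> (\<forall>(k, j)\<in>both_dirs E. 0 \<le> \<gamma> k j + lower_bd n E \<gamma> \<delta>hat k - lower_bd n E \<gamma> \<delta>hat j)
    \<and> (\<forall>j\<in>{1..n}. 0 \<le> upper_bd n E \<gamma> \<delta>hat j - lower_bd n E \<gamma> \<delta>hat j)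
    \<and> (\<forall>a\<in>arcs (ext_graph n E d). 0 \<le> red_cost n E \<gamma> \<delta>hat d a)
    \<and> (\<forall>p. pre_digraph.cycle (ext_graph n E d) p \<longrightarrow>
         0 \<le> wf_digraph.awalk_cost (red_cost n E \<gamma> \<delta>hat d) p)"
proof -
  interpret dummy_network n E d
    by unfold_locales (fact edges dummy)+
  interpret weighted_graph n E \<gamma>
    by unfold_locales (fact conn weight_nonneg)+
  let ?l = "lower_bd n E \<gamma> \<delta>hat" and ?u = "upper_bd n E \<gamma> \<delta>hat" and ?c = "red_cost n E \<gamma> \<delta>hat d"
  obtain \<delta> where \<delta>: "\<delta> \<in> uncertainty_set n E \<gamma> \<delta>hat"
    using nonempty by blast
  have edge_cost: "0 \<le> \<gamma> k j + ?l k - ?l j" if kj: "(k, j) \<in> both_dirs E" for k j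
  proof -
    \<comment> \<open>The path to \<open>j\<close> is extended by the reversed arc; symmetry of the weights returns to \<open>\<gamma> k j\<close>.\<close>
    have "(j, k) \<in> both_dirs E"
      using kj both_dirs_commute by blast
    then have "?l j \<le> ?l k + \<gamma> j k"
      by (rule lower_bd_step)
    moreover have "\<gamma> j k = \<gamma> k j"
      using weight_sym[of k j] kj by (simp add: both_dirs_def)
    ultimately show ?thesis
      by simp
  qed
  have bound_cost: "0 \<le> ?u j - ?l j" if "j \<in> {1..n}" for j
    using uncertainty_set_bounds[OF \<delta> that] by simp
  have cost_nonneg: "0 \<le> ?c a" if "a \<in> arcs N" for a
    using that edge_cost bound_cost no_edge_at_dummy
    by (cases a) (auto simp: arcs_N red_cost_def simp del: atLeastAtMost_iff)
  have cycle_nonneg: "0 \<le> N.awalk_cost ?c p" if "N.cycle p" for p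
    using that N.pos_cost_pos_awalk_cost cost_nonneg by (auto simp: N.cycle_def)
  show ?thesis
    using edge_cost bound_cost cost_nonneg cycle_nonneg lp_objective_eq_red_objective
    by (intro conjI ballI allI impI min_cost_flow_problem_lp_feasible)
      (auto simp: lp_objective_eq_arc_sum red_objective_eq_arc_sum)
qed

end
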